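(* Let $A_K^*\in\mathbb{R}^{n\times n}$, let $x^*(0)\in\mathbb{R}^n$, and let $x^*(t)=e^{A_K^* t}x^*(0)$. Fix sample times $t_1,\dots,t_N$, one of which equals $0$, so that $x^*(0)$ is a column of $\Lambda_0$. Let $\Lambda_i$, $\bar\Lambda_1$, $\bar\Lambda_2$ be the data matrices defined in the context. If $M\in\mathbb{R}^{n\times n}$ satisfies $M\bar\Lambda_1=\bar\Lambda_2$, then the solution $\hat x$ of $\dot{\hat x}=M\hat x$ with $\hat x(0)=x^*(0)$ satisfies $\hat x(t)=x^*(t)$ for all $t$.
   Context: Data matrices: for each $i=0,1,\dots,n$, let $x^{*(i)}$ denote the $i$-th time derivative of $x^*$. Define $\Lambda_i=[x^{*(i)}(t_1)\ \cdots\ x^{*(i)}(t_N)]\in\mathbb{R}^{n\times N}$. Define $\bar\Lambda_1=[\Lambda_0\ \Lambda_1\ \cdots\ \Lambda_{n-1}]\in\mathbb{R}^{n\times nN}$ and $\bar\Lambda_2=[\Lambda_1\ \Lambda_2\ \cdots\ \Lambda_n]\in\mathbb{R}^{n\times nN}$. In particular $\Lambda_{i}=A_K^*\Lambda_{i-1}$ for $i=1,\dots,n$, and $A_K^*\bar\Lambda_1=\bar\Lambda_2$. *)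

theory Defs
  imports "HOL-Analysis.Analysis"
begin

text \<open>Matrix powers and the matrix exponential e^A = sum_k A^k / k!.\<close>

primrec mat_pow :: "real^'n^'n \<Rightarrow> nat \<Rightarrow> real^'n^'n" where
  "mat_pow A 0 = mat 1"
| "mat_pow A (Suc k) = A ** mat_pow A k"

definition mat_exp :: "real^'n^'n \<Rightarrow> real^'n^'n" where
  "mat_exp A = (\<Sum>k. (1 / fact k) *\<^sub>R mat_pow A k)"

text \<open>i-th time derivative of a vector-valued function, taken componentwise.\<close>

definition vderiv_n :: "nat \<Rightarrow> (real \<Rightarrow> real^'n) \<Rightarrow> real \<Rightarrow> real^'n" where
  "vderiv_n i f t = (\<chi> k. (deriv ^^ i) (\<lambda>s. f s $ k) t)"

text \<open>Data matrix Lambda_i = [x^(i)(t_1) ... x^(i)(t_N)], columns indexed by the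
  finite sample index type 'm.\<close>

definition data_mat :: "(real \<Rightarrow> real^'n) \<Rightarrow> ('m \<Rightarrow> real) \<Rightarrow> nat \<Rightarrow> real^'m^'n" where
  "data_mat x ts i = (\<chi> r c. vderiv_n i x (ts c) $ r)"

end

(* The data column at the sample time 0 is the Krylov sequence x0, A x0, A^2 x0, ..., because the
   i-th derivative of e^(tA) x0 is e^(tA) A^i x0; so the hypothesis says M A^i x0 = A^(i+1) x0 for
   i < n.  By a dimension count some A^d x0 with d <= n lies in the span of x0, ..., A^(d-1) x0; that
   span is then A-invariant and contains every A^k x0, and M agrees with A on it.  Hence
   M A^k x0 = A^(k+1) x0 for all k, and summing the exponential series gives
   d/dt e^(tA) x0 = M e^(tA) x0.  Both trajectories thus solve the same linear ODE with the same
   initial value, and a Gronwall estimate for the squared norm of their difference shows that they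
   coincide. *)

theory Submission
  imports Defs
begin

lemma mat_pow_Suc_right: "mat_pow A (Suc k) = mat_pow A k ** A"
  by (induction k) (simp_all add: matrix_mul_assoc)

lemma mat_pow_scaleR: "mat_pow (t *\<^sub>R A) k = (t ^ k) *\<^sub>R mat_pow A k"
  by (induction k) (simp_all add: matrix_scalar_ac scalar_matrix_assoc mult.commute)

lemma onorm_mat_pow_le: "onorm ((*v) (mat_pow (A::real^'n^'n) k)) \<le> onorm ((*v) A) ^ k"
proof (induction k)
  case 0
  then show ?case by (simp add: onorm_id)
next
  case (Suc k)
  have "(*v) (mat_pow A (Suc k)) = (*v) A \<circ> (*v) (mat_pow A k)"
    by (simp add: fun_eq_iff matrix_vector_mul_assoc)
  then have "onorm ((*v) (mat_pow A (Suc k))) \<le> onorm ((*v) A) * onorm ((*v) (mat_pow A k))"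
    by (simp add: onorm_compose)
  also have "\<dots> \<le> onorm ((*v) A) * onorm ((*v) A) ^ k"
    using Suc by (simp add: mult_left_mono onorm_pos_le)
  finally show ?case by simp
qed

lemma norm_le_sum_abs_entries: "norm (X::real^'n^'m) \<le> (\<Sum>i\<in>UNIV. \<Sum>j\<in>UNIV. \<bar>X $ i $ j\<bar>)"
proof -
  have "norm X \<le> (\<Sum>i\<in>UNIV. norm (X $ i))"
    unfolding norm_vec_def by (rule L2_set_le_sum) simp
  also have "\<dots> \<le> (\<Sum>i\<in>UNIV. \<Sum>j\<in>UNIV. \<bar>X $ i $ j\<bar>)"
    by (intro sum_mono norm_le_l1_cart)
  finally show ?thesis .
qed

lemma norm_mat_pow_le:
  "norm (mat_pow (A::real^'n^'n) k) \<le> real CARD('n) ^ 2 * onorm ((*v) A) ^ k"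
proof -
  have "\<bar>mat_pow A k $ i $ j\<bar> \<le> onorm ((*v) A) ^ k" for i j
    using matrix_component_le_onorm onorm_mat_pow_le by (rule order_trans)
  then have "(\<Sum>i\<in>UNIV. \<Sum>j\<in>UNIV. \<bar>mat_pow A k $ i $ j\<bar>) \<le>
      (\<Sum>i\<in>(UNIV::'n set). \<Sum>j\<in>(UNIV::'n set). onorm ((*v) A) ^ k)"
    by (intro sum_mono)
  then show ?thesis
    using norm_le_sum_abs_entries[of "mat_pow A k"] by (simp add: power2_eq_square)
qed

lemma mat_exp_sums: "(\<lambda>k. (1 / fact k) *\<^sub>R mat_pow A k) sums mat_exp (A::real^'n^'n)"
proof -
  define C K where "C = real CARD('n) ^ 2" and "K = onorm ((*v) A)"
  have "summable (\<lambda>k. C * (inverse (fact k) * K ^ k))"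
    by (intro summable_mult summable_exp)
  moreover have "norm ((1 / fact k) *\<^sub>R mat_pow A k) \<le> C * (inverse (fact k) * K ^ k)" for k
    using norm_mat_pow_le[of A k] by (simp add: C_def K_def divide_inverse mult_left_mono)
  ultimately have "summable (\<lambda>k. (1 / fact k) *\<^sub>R mat_pow A k)"
    by (rule summable_comparison_test')
  then show ?thesis
    unfolding mat_exp_def by (rule summable_sums)
qed

lemma bounded_linear_matrix_vector_mult_left: "bounded_linear (\<lambda>X::real^'n^'m. X *v v)"
proof -
  have "linear (\<lambda>X::real^'n^'m. X *v v)"
    by (rule linearI) (simp_all add: matrix_vector_mult_add_rdistrib scaleR_matrix_vector_assoc)
  then show ?thesis
    by (simp add: linear_conv_bounded_linear)
qed

lemma mat_exp_scaleR_mult_vec_sums: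
  "(\<lambda>k. (t ^ k / fact k) *\<^sub>R (mat_pow A k *v v)) sums (mat_exp (t *\<^sub>R A) *v (v::real^'n))"
  using bounded_linear.sums[OF bounded_linear_matrix_vector_mult_left mat_exp_sums[of "t *\<^sub>R A"]]
  by (simp add: mat_pow_scaleR scaleR_matrix_vector_assoc)

lemma mat_exp_scaleR_mult_vec_component_sums:
  "(\<lambda>k. ((mat_pow A k *v v) $ r / fact k) * t ^ k) sums ((mat_exp (t *\<^sub>R A) *v (v::real^'n)) $ r)"
  using sums_vec_nth[OF mat_exp_scaleR_mult_vec_sums[of t A v], of r] by (simp add: field_simps)

lemma mat_exp_zero [simp]: "mat_exp (0::real^'n^'n) = mat 1"
proof -
  have zero_mult: "(0::real^'n^'n) ** B = 0" for B
    by (simp add: matrix_matrix_mult_def vec_eq_iff)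
  have "(1 / fact k) *\<^sub>R mat_pow (0::real^'n^'n) k = (if k = 0 then mat 1 else 0)" for k
    by (cases k) (simp_all add: zero_mult)
  then have "(\<lambda>k. if k = 0 then mat 1 else 0) sums mat_exp (0::real^'n^'n)"
    by (rule sums_cong[THEN iffD1]) (rule mat_exp_sums)
  moreover have "(\<lambda>k. if k = 0 then mat 1 else 0) sums (mat 1 :: real^'n^'n)"
    using sums_single[of 0 "\<lambda>_. mat 1"] by simp
  ultimately show ?thesis
    by (rule sums_unique2)
qed

lemma mat_exp_scaleR_mult_vec_component_has_derivative:
  "((\<lambda>s. (mat_exp (s *\<^sub>R A) *v v) $ r) has_real_derivative
     (mat_exp (t *\<^sub>R A) *v (A *v (v::real^'n))) $ r) (at t)"
proof -
  define c where "c k = (mat_pow A k *v v) $ r / fact k" for k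
  have fun_eq: "(\<lambda>s. (mat_exp (s *\<^sub>R A) *v v) $ r) = (\<lambda>s. \<Sum>k. c k * s ^ k)"
    unfolding c_def by (intro ext sums_unique mat_exp_scaleR_mult_vec_component_sums)
  have summable: "summable (\<lambda>k. c k * s ^ k)" for s
    unfolding c_def by (rule sums_summable, rule mat_exp_scaleR_mult_vec_component_sums)
  have "diffs c k = (mat_pow A k *v (A *v v)) $ r / fact k" for k
  proof -
    have "diffs c k = (mat_pow A (Suc k) *v v) $ r / fact k"
      by (simp add: diffs_def c_def fact_Suc del: of_nat_Suc)
    then show ?thesis
      by (simp only: mat_pow_Suc_right matrix_vector_mul_assoc)
  qed
  then have "(\<Sum>k. diffs c k * t ^ k) = (mat_exp (t *\<^sub>R A) *v (A *v v)) $ r"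
    by (simp add: sums_unique[OF mat_exp_scaleR_mult_vec_component_sums])
  then show ?thesis
    using termdiffs_strong_converges_everywhere[OF summable, of t] unfolding fun_eq by simp
qed

lemma mat_exp_scaleR_mult_vec_has_vector_derivative:
  "((\<lambda>s. mat_exp (s *\<^sub>R A) *v v) has_vector_derivative
     mat_exp (t *\<^sub>R A) *v (A *v (v::real^'n))) (at t)"
  unfolding has_vector_derivative_def
proof (subst has_derivative_componentwise_within, intro ballI)
  fix b :: "real^'n"
  assume "b \<in> Basis"
  then obtain r where b: "b = axis r 1"
    by (auto simp: Basis_vec_def)
  show "((\<lambda>s. (mat_exp (s *\<^sub>R A) *v v) \<bullet> b) has_derivative
      (\<lambda>h. (h *\<^sub>R (mat_exp (t *\<^sub>R A) *v (A *v v))) \<bullet> b)) (at t)"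
    using mat_exp_scaleR_mult_vec_component_has_derivative[of A v r t]
    unfolding b has_field_derivative_def
    by (simp add: cart_eq_inner_axis[symmetric] mult_commute_abs)
qed

lemma higher_deriv_mat_exp_scaleR_mult_vec_component:
  "(deriv ^^ i) (\<lambda>s. (mat_exp (s *\<^sub>R A) *v v) $ r) =
     (\<lambda>s. (mat_exp (s *\<^sub>R A) *v (mat_pow A i *v (v::real^'n))) $ r)"
proof (induction i)
  case 0
  then show ?case by simp
next
  case (Suc i)
  have "(deriv ^^ Suc i) (\<lambda>s. (mat_exp (s *\<^sub>R A) *v v) $ r) =
      deriv (\<lambda>s. (mat_exp (s *\<^sub>R A) *v (mat_pow A i *v v)) $ r)"
    using Suc by simp
  also have "\<dots> = (\<lambda>s. (mat_exp (s *\<^sub>R A) *v (A *v (mat_pow A i *v v))) $ r)"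
    by (intro ext DERIV_imp_deriv mat_exp_scaleR_mult_vec_component_has_derivative)
  finally show ?case
    by (simp add: matrix_vector_mul_assoc)
qed

lemma vderiv_n_mat_exp_scaleR_mult_vec:
  "vderiv_n i (\<lambda>s. mat_exp (s *\<^sub>R A) *v v) t = mat_exp (t *\<^sub>R A) *v (mat_pow A i *v (v::real^'n))"
  by (simp add: vderiv_n_def higher_deriv_mat_exp_scaleR_mult_vec_component vec_eq_iff)

lemma column_data_mat: "column j (data_mat x ts i) = vderiv_n i x (ts j)"
  by (simp add: column_def data_mat_def vec_eq_iff)

lemma column_matrix_matrix_mult: "column j (M ** X) = M *v column j (X::real^'m^'k)"
  by (simp add: column_def matrix_matrix_mult_def matrix_vector_mult_def vec_eq_iff)

lemma krylov_step_of_data_mat: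
  assumes "ts j = 0"
    and "M ** data_mat (\<lambda>s. mat_exp (s *\<^sub>R A) *v x) ts i =
      data_mat (\<lambda>s. mat_exp (s *\<^sub>R A) *v x) ts (Suc i)"
  shows "M *v (mat_pow A i *v x) = mat_pow A (Suc i) *v (x::real^'n)"
  using arg_cong[OF assms(2), of "column j"] assms(1)
  by (simp add: column_matrix_matrix_mult column_data_mat vderiv_n_mat_exp_scaleR_mult_vec
      del: mat_pow.simps)

lemma mat_exp_scaleR_mult_vec_solves_ode:
  fixes A M :: "real^'n^'n"
  assumes "\<And>k. M *v (mat_pow A k *v x) = mat_pow A (Suc k) *v x"
  shows "((\<lambda>s. mat_exp (s *\<^sub>R A) *v x) has_vector_derivative M *v (mat_exp (t *\<^sub>R A) *v x)) (at t)"
proof -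
  have "(\<lambda>k. M *v ((t ^ k / fact k) *\<^sub>R (mat_pow A k *v x))) sums (M *v (mat_exp (t *\<^sub>R A) *v x))"
    by (rule bounded_linear.sums[OF matrix_vector_mul_bounded_linear mat_exp_scaleR_mult_vec_sums])
  moreover have "M *v ((t ^ k / fact k) *\<^sub>R (mat_pow A k *v x)) =
      (t ^ k / fact k) *\<^sub>R (mat_pow A k *v (A *v x))" for k
    using assms[of k]
    by (simp add: matrix_vector_mult_scaleR matrix_vector_mul_assoc mat_pow_Suc_right del: mat_pow.simps)
  ultimately have "(\<lambda>k. (t ^ k / fact k) *\<^sub>R (mat_pow A k *v (A *v x))) sums
      (M *v (mat_exp (t *\<^sub>R A) *v x))"
    by simp
  then have "M *v (mat_exp (t *\<^sub>R A) *v x) = mat_exp (t *\<^sub>R A) *v (A *v x)"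
    by (rule sums_unique2[OF _ mat_exp_scaleR_mult_vec_sums])
  then show ?thesis
    using mat_exp_scaleR_mult_vec_has_vector_derivative by simp
qed

definition krylov_space :: "real^'n^'n \<Rightarrow> real^'n \<Rightarrow> nat \<Rightarrow> (real^'n) set" where
  "krylov_space A x d = span ((\<lambda>i. mat_pow A i *v x) ` {..<d})"

lemma krylov_space_stabilizes:
  "\<exists>d\<le>CARD('n). mat_pow A d *v x \<in> krylov_space A (x::real^'n) d"
proof (rule ccontr)
  assume "\<not> ?thesis"
  then have "dim ((\<lambda>i. mat_pow A i *v x) ` {..<d}) = d" if "d \<le> Suc CARD('n)" for d
    using that
  proof (induction d)
    case (Suc d)
    then show ?case
      by (simp add: lessThan_Suc dim_insert krylov_space_def)
  qed simp
  then have "dim ((\<lambda>i. mat_pow A i *v x) ` {..<Suc CARD('n)}) = Suc CARD('n)"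
    by simp
  moreover have "dim ((\<lambda>i. mat_pow A i *v x) ` {..<Suc CARD('n)}) \<le> CARD('n)"
    by (rule dim_subset_UNIV_cart)
  ultimately show False
    by simp
qed

lemma krylov_space_invariant:
  assumes "mat_pow A d *v x \<in> krylov_space A x d" and "y \<in> krylov_space A x d"
  shows "A *v y \<in> krylov_space A (x::real^'n) d"
proof -
  have "A *v (mat_pow A i *v x) \<in> krylov_space A x d" if "i < d" for i
  proof -
    have "Suc i = d \<or> Suc i < d"
      using that by auto
    then have "mat_pow A (Suc i) *v x \<in> krylov_space A x d"
      using assms(1) unfolding krylov_space_def by (auto intro: span_base simp del: mat_pow.simps)
    then show ?thesis
      by (simp add: matrix_vector_mul_assoc)
  qed
  then have "(*v) A ` (\<lambda>i. mat_pow A i *v x) ` {..<d} \<subseteq> krylov_space A x d"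
    by auto
  then have "span ((*v) A ` (\<lambda>i. mat_pow A i *v x) ` {..<d}) \<subseteq> krylov_space A x d"
    unfolding krylov_space_def by (rule span_minimal) (rule subspace_span)
  then have "(*v) A ` krylov_space A x d \<subseteq> krylov_space A x d"
    by (simp add: krylov_space_def span_linear_image)
  then show ?thesis
    using assms(2) by blast
qed

lemma mat_pow_mult_vec_in_krylov_space: "mat_pow A k *v x \<in> krylov_space A (x::real^'n) CARD('n)"
proof -
  obtain d where d: "d \<le> CARD('n)" "mat_pow A d *v x \<in> krylov_space A x d"
    using krylov_space_stabilizes by blast
  have "mat_pow A k *v x \<in> krylov_space A x d"
  proof (induction k)
    case 0
    show ?case
    proof (cases "d = 0")
      case True
      then show ?thesis using d(2) by simp
    next
      case False
      then have "mat_pow A 0 *v x \<in> (\<lambda>i. mat_pow A i *v x) ` {..<d}"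
        by blast
      then show ?thesis
        unfolding krylov_space_def by (rule span_base)
    qed
  next
    case (Suc k)
    then show ?case
      using krylov_space_invariant[OF d(2) Suc] by (simp add: matrix_vector_mul_assoc)
  qed
  moreover have "krylov_space A x d \<subseteq> krylov_space A x CARD('n)"
    unfolding krylov_space_def using d(1) by (intro span_mono image_mono) auto
  ultimately show ?thesis
    by blast
qed

lemma agrees_on_all_krylov_vectors:
  fixes A M :: "real^'n^'n"
  assumes "\<forall>i<CARD('n). M *v (mat_pow A i *v x) = mat_pow A (Suc i) *v x"
  shows "M *v (mat_pow A k *v x) = mat_pow A (Suc k) *v x"
proof -
  have agree: "M *v y = A *v y" if "y \<in> krylov_space A x CARD('n)" for y
  proof (rule linear_eq_on_span[of "(*v) M" "(*v) A"])
    fix b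
    assume "b \<in> (\<lambda>i. mat_pow A i *v x) ` {..<CARD('n)}"
    then show "M *v b = A *v b"
      using assms by (auto simp: matrix_vector_mul_assoc)
  qed (use that in \<open>simp_all add: krylov_space_def\<close>)
  have "M *v (mat_pow A k *v x) = A *v (mat_pow A k *v x)"
    by (rule agree[OF mat_pow_mult_vec_in_krylov_space])
  then show ?thesis
    by (simp add: matrix_vector_mul_assoc)
qed

lemma gronwall_zero:
  fixes f f' :: "real \<Rightarrow> real"
  assumes deriv: "\<And>s. (f has_real_derivative f' s) (at s)"
    and growth: "\<And>s. f' s \<le> c * f s"
    and nonneg: "\<And>s. 0 \<le> f s"
    and "f 0 = 0" and "0 \<le> t"
  shows "f t = 0"
proof -
  define h where "h s = exp (- c * s) * f s" for s
  have "h t \<le> h 0"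
  proof (rule DERIV_nonpos_imp_nonincreasing[OF \<open>0 \<le> t\<close>])
    fix s
    have "(h has_real_derivative exp (- c * s) * (f' s - c * f s)) (at s)"
      unfolding h_def by (auto intro!: derivative_eq_intros deriv simp: algebra_simps)
    moreover have "exp (- c * s) * (f' s - c * f s) \<le> 0"
      using growth[of s] by (simp add: mult_nonneg_nonpos)
    ultimately show "\<exists>y. (h has_real_derivative y) (at s) \<and> y \<le> 0"
      by blast
  qed
  then have "f t \<le> 0"
    by (simp add: h_def \<open>f 0 = 0\<close> mult_le_0_iff)
  then show ?thesis
    using nonneg[of t] by simp
qed

lemma linear_ode_zero_forward:
  fixes M :: "real^'n^'n" and z :: "real \<Rightarrow> real^'n"
  assumes ode: "\<And>t. (z has_vector_derivative (M *v z t)) (at t)"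
    and "z 0 = 0" and "0 \<le> t"
  shows "z t = 0"
proof -
  define K where "K = onorm ((*v) M)"
  have energy_deriv: "((\<lambda>s. z s \<bullet> z s) has_real_derivative 2 * (z s \<bullet> (M *v z s))) (at s)" for s
  proof -
    have "(z has_derivative (\<lambda>h. h *\<^sub>R (M *v z s))) (at s)"
      using ode[of s] by (simp add: has_vector_derivative_def)
    from has_derivative_inner[OF this this]
    show ?thesis
      by (simp add: has_field_derivative_def inner_commute algebra_simps mult_commute_abs)
  qed
  have "2 * (z s \<bullet> (M *v z s)) \<le> 2 * K * (z s \<bullet> z s)" for s
  proof -
    have "z s \<bullet> (M *v z s) \<le> norm (z s) * norm (M *v z s)"
      by (rule norm_cauchy_schwarz)
    also have "\<dots> \<le> norm (z s) * (K * norm (z s))"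
      unfolding K_def by (intro mult_left_mono onorm) simp_all
    finally show ?thesis
      by (simp add: power2_norm_eq_inner[symmetric] power2_eq_square algebra_simps)
  qed
  then have "z t \<bullet> z t = 0"
    by (rule gronwall_zero[OF energy_deriv]) (simp_all add: \<open>z 0 = 0\<close> \<open>0 \<le> t\<close>)
  then show ?thesis
    by simp
qed

lemma linear_ode_zero:
  fixes M :: "real^'n^'n" and z :: "real \<Rightarrow> real^'n"
  assumes ode: "\<And>t. (z has_vector_derivative (M *v z t)) (at t)" and "z 0 = 0"
  shows "z t = 0"
proof (cases "0 \<le> t")
  case True
  then show ?thesis
    using linear_ode_zero_forward[OF ode \<open>z 0 = 0\<close>] by blast
next
  case False
  have neg: "(- M) *v v = - (M *v v)" for v
    by (simp add: vec_eq_iff matrix_vector_mult_def sum_negf)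
  have "(uminus has_vector_derivative - 1) (at s)" for s :: real
    using has_real_derivative_iff_has_vector_derivative DERIV_minus[OF DERIV_ident] by blast
  then have "((z \<circ> uminus) has_vector_derivative (- 1) *\<^sub>R (M *v z (- s))) (at s)" for s
    using vector_diff_chain_at ode by blast
  then have "((\<lambda>s. z (- s)) has_vector_derivative (- M) *v z (- s)) (at s)" for s
    by (simp add: o_def neg)
  then have "z (- (- t)) = 0"
    by (rule linear_ode_zero_forward) (use False \<open>z 0 = 0\<close> in auto)
  then show ?thesis
    by simp
qed

theorem lemma3:
  fixes A M :: "real^'n^'n" and x0 :: "real^'n"
    and ts :: "'m::finite \<Rightarrow> real"
    and xs xh :: "real \<Rightarrow> real^'n"
  assumes xs_def: "\<And>t. xs t = mat_exp (t *\<^sub>R A) *v x0"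
    and zero_sample: "\<exists>j. ts j = 0"
    and M_data: "\<forall>i<CARD('n). M ** data_mat xs ts i = data_mat xs ts (Suc i)"
    and xh_ode: "\<And>t. (xh has_vector_derivative (M *v xh t)) (at t)"
    and xh_init: "xh 0 = x0"
  shows "\<forall>t. xh t = xs t"
proof
  fix t
  have xs_eq: "xs = (\<lambda>s. mat_exp (s *\<^sub>R A) *v x0)"
    using xs_def by (intro ext)
  obtain j where "ts j = 0"
    using zero_sample by blast
  then have "\<forall>i<CARD('n). M *v (mat_pow A i *v x0) = mat_pow A (Suc i) *v x0"
    using M_data unfolding xs_eq by (blast intro: krylov_step_of_data_mat)
  then have "(xs has_vector_derivative M *v xs s) (at s)" for s
    unfolding xs_eq by (rule mat_exp_scaleR_mult_vec_solves_ode[OF agrees_on_all_krylov_vectors])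
  then have "((\<lambda>s. xh s - xs s) has_vector_derivative M *v (xh s - xs s)) (at s)" for s
    using has_vector_derivative_diff[OF xh_ode] by (simp add: matrix_vector_mult_diff_distrib)
  moreover have "xh 0 - xs 0 = 0"
    by (simp add: xh_init xs_def)
  ultimately have "xh t - xs t = 0"
    by (rule linear_ode_zero)
  then show "xh t = xs t"
    by simp
qed

end
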